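(* Let $a>0$, $\gamma>0$ and $A_0>0$, and let $f=f^\ast\in\mathcal{A}$ be a minimizer of $J$ over $\mathcal{A}$. Then there exists $\lambda\in\mathbb{R}$ such that $f$ satisfies, in the sense of distributions on $(-a,a)$, the Euler--Lagrange equation $$\frac{d^2}{dx^2}\left(\frac{2\gamma f''}{(1+f'^2)^{5/2}}\right)-\frac{d}{dx}\left(\frac{f'}{\sqrt{1+f'^2}}-\frac{5\gamma (f'')^2 f'}{(1+f'^2)^{7/2}}\right)+\lambda=0 .$$
   Context: For $a>0$ and $A_0>0$, the admissible class is $$\mathcal{A}=\left\{f\in W^{2,2}([-a,a]) : f(\pm a)=0,\ f'(\pm a)=0,\ \int_{-a}^{a}f(x)\,dx=A_0\right\},$$ where functions in the Sobolev space $W^{2,2}([-a,a])$ are real-valued and identified with their $C^1$ representatives. For a constant $\gamma>0$ and $f\in W^{2,2}([-a,a])$, with curvature $\kappa=\dfrac{f''}{(1+f'^2)^{3/2}}$, $$J[f]=\int_{-a}^{a}\bigl(1+\gamma\kappa^2\bigr)\sqrt{1+f'^2}\,dx=\int_{-a}^{a}\left(\sqrt{1+f'^2}+\gamma\frac{(f'')^2}{(1+f'^2)^{5/2}}\right)dx .$$ A minimizer of $J$ over $\mathcal{A}$ is an element $f^\ast\in\mathcal{A}$ with $J[f^\ast]\le J[f]$ for all $f\in\mathcal{A}$. *)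

theory Defs
  imports "HOL-Analysis.Analysis"
begin

definition test_function :: "real \<Rightarrow> real \<Rightarrow> (real \<Rightarrow> real) \<Rightarrow> bool" where
  "test_function l u \<phi> \<longleftrightarrow>
     (\<forall>n x. (deriv ^^ n) \<phi> field_differentiable (at x)) \<and>
     compact (closure {x. \<phi> x \<noteq> 0}) \<and> closure {x. \<phi> x \<noteq> 0} \<subseteq> {l<..<u}"

definition locally_integrable :: "real \<Rightarrow> real \<Rightarrow> (real \<Rightarrow> real) \<Rightarrow> bool" where
  "locally_integrable l u g \<longleftrightarrow>
     (\<forall>K. compact K \<and> K \<subseteq> {l<..<u} \<longrightarrow> set_integrable lebesgue K g)"

text \<open>Distributions on the interval from \<open>l\<close> to \<open>u\<close> are represented as functionals on functions,
  of which only the values on test functions are relevant.\<close>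

definition regular_dist :: "real \<Rightarrow> real \<Rightarrow> (real \<Rightarrow> real) \<Rightarrow> (real \<Rightarrow> real) \<Rightarrow> real" where
  "regular_dist l u g \<phi> = (LINT x:{l<..<u}|lebesgue. g x * \<phi> x)"

definition dist_deriv :: "((real \<Rightarrow> real) \<Rightarrow> real) \<Rightarrow> (real \<Rightarrow> real) \<Rightarrow> real" where
  "dist_deriv T \<phi> = - T (deriv \<phi>)"

definition has_weak_deriv ::
  "nat \<Rightarrow> real \<Rightarrow> real \<Rightarrow> (real \<Rightarrow> real) \<Rightarrow> (real \<Rightarrow> real) \<Rightarrow> bool" where
  "has_weak_deriv k l u f g \<longleftrightarrow>
     locally_integrable l u f \<and> locally_integrable l u g \<and>
     (\<forall>\<phi>. test_function l u \<phi> \<longrightarrow>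
        (LINT x:{l<..<u}|lebesgue. f x * (deriv ^^ k) \<phi> x) =
        (- 1) ^ k * (LINT x:{l<..<u}|lebesgue. g x * \<phi> x))"

definition L2 :: "real \<Rightarrow> real \<Rightarrow> (real \<Rightarrow> real) set" where
  "L2 l u = {g. g \<in> borel_measurable (lebesgue_on {l..u}) \<and>
                set_integrable lebesgue {l..u} (\<lambda>x. (g x)\<^sup>2)}"

text \<open>Derivatives at the endpoints are one-sided: elements of the function space below are
  functions on the whole type, but only their restrictions to \<open>{l..u}\<close> matter.\<close>

definition C1_on :: "real \<Rightarrow> real \<Rightarrow> (real \<Rightarrow> real) \<Rightarrow> bool" where
  "C1_on l u f \<longleftrightarrow>
     (\<exists>D. continuous_on {l..u} D \<and>
          (\<forall>x\<in>{l..u}. (f has_real_derivative D x) (at x within {l..u})))"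

definition W22 :: "real \<Rightarrow> real \<Rightarrow> (real \<Rightarrow> real) set" where
  "W22 l u = {f. C1_on l u f \<and> f \<in> L2 l u \<and>
                 (\<exists>g\<in>L2 l u. has_weak_deriv 1 l u f g) \<and>
                 (\<exists>h\<in>L2 l u. has_weak_deriv 2 l u f h)}"

text \<open>On \<^term>\<open>W22 l u\<close>, the first derivative is the classical (continuous) one; the second is a
  representative of the weak one, unique up to null sets.\<close>

definition D1 :: "real \<Rightarrow> real \<Rightarrow> (real \<Rightarrow> real) \<Rightarrow> real \<Rightarrow> real" where
  "D1 l u f x = vector_derivative f (at x within {l..u})"

definition D2 :: "real \<Rightarrow> real \<Rightarrow> (real \<Rightarrow> real) \<Rightarrow> real \<Rightarrow> real" where
  "D2 l u f = (SOME h. h \<in> L2 l u \<and> has_weak_deriv 2 l u f h)"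

definition curvature :: "real \<Rightarrow> real \<Rightarrow> (real \<Rightarrow> real) \<Rightarrow> real \<Rightarrow> real" where
  "curvature l u f x = D2 l u f x / (1 + (D1 l u f x)\<^sup>2) powr (3/2)"

definition J :: "real \<Rightarrow> real \<Rightarrow> (real \<Rightarrow> real) \<Rightarrow> real" where
  "J a \<gamma> f = (LINT x:{-a..a}|lebesgue.
      (1 + \<gamma> * (curvature (-a) a f x)\<^sup>2) * sqrt (1 + (D1 (-a) a f x)\<^sup>2))"

definition admissible :: "real \<Rightarrow> real \<Rightarrow> (real \<Rightarrow> real) set" where
  "admissible a A\<^sub>0 = {f \<in> W22 (-a) a.
      f (-a) = 0 \<and> f a = 0 \<and> D1 (-a) a f (-a) = 0 \<and> D1 (-a) a f a = 0 \<and>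
      (LINT x:{-a..a}|lebesgue. f x) = A\<^sub>0}"

definition is_minimizer :: "real \<Rightarrow> real \<Rightarrow> real \<Rightarrow> (real \<Rightarrow> real) \<Rightarrow> bool" where
  "is_minimizer a \<gamma> A\<^sub>0 f \<longleftrightarrow> f \<in> admissible a A\<^sub>0 \<and> (\<forall>g\<in>admissible a A\<^sub>0. J a \<gamma> f \<le> J a \<gamma> g)"

text \<open>The remaining facts show that the Lebesgue integrals above never take the default value of
  a non-integrable function: the integrand of \<open>J\<close> and both coefficients of the Euler--Lagrange
  equation are integrable for every element of the Sobolev space.\<close>

lemma D1_has_derivative:
  assumes "l < u" "C1_on l u f"
  shows "continuous_on {l..u} (D1 l u f)"
    and "x \<in> {l..u} \<Longrightarrow> (f has_real_derivative D1 l u f x) (at x within {l..u})"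
proof -
  obtain D where D: "continuous_on {l..u} D"
      "\<And>x. x \<in> {l..u} \<Longrightarrow> (f has_real_derivative D x) (at x within {l..u})"
    using assms(2) unfolding C1_on_def by blast
  have eq: "D1 l u f x = D x" if "x \<in> {l..u}" for x
    using vector_derivative_within_cbox[of l u x f "D x"] assms(1) that D(2)[OF that]
    by (simp add: D1_def has_real_derivative_iff_has_vector_derivative)
  show "continuous_on {l..u} (D1 l u f)"
    by (rule continuous_on_eq[OF D(1)]) (simp add: eq)
  show "x \<in> {l..u} \<Longrightarrow> (f has_real_derivative D1 l u f x) (at x within {l..u})"
    using D(2) eq by simp
qed

lemma D2_weak_deriv:
  assumes "f \<in> W22 l u"
  shows "D2 l u f \<in> L2 l u" "has_weak_deriv 2 l u f (D2 l u f)"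
proof -
  have "\<exists>h. h \<in> L2 l u \<and> has_weak_deriv 2 l u f h"
    using assms by (auto simp: W22_def)
  from someI_ex[OF this] show "D2 l u f \<in> L2 l u" "has_weak_deriv 2 l u f (D2 l u f)"
    by (simp_all add: D2_def)
qed

lemma continuous_mult_integrable:
  fixes c g :: "real \<Rightarrow> real"
  assumes "continuous_on {l..u} c" "set_integrable lebesgue {l..u} g"
  shows "set_integrable lebesgue {l..u} (\<lambda>x. c x * g x)"
proof (rule absolutely_integrable_bounded_measurable_product_real)
  show "c \<in> borel_measurable (lebesgue_on {l..u})"
    by (intro continuous_imp_measurable_on_sets_lebesgue assms(1)) auto
  show "bounded (c ` {l..u})"
    by (intro compact_imp_bounded compact_continuous_image assms(1)) auto
qed (use assms(2) in auto)

lemma continuous_set_integrable: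
  fixes c :: "real \<Rightarrow> real"
  assumes "continuous_on {l..u} c"
  shows "set_integrable lebesgue {l..u} c"
  by (rule absolutely_integrable_continuous_real[OF assms])

lemma L2_set_integrable:
  assumes "g \<in> L2 l u"
  shows "set_integrable lebesgue {l..u} g"
proof -
  interpret finite_measure "lebesgue_on {l..u}"
    by (intro finite_measureI) (auto simp: emeasure_restrict_space emeasure_lborel_Icc_eq)
  have "integrable (lebesgue_on {l..u}) (\<lambda>x. (g x)\<^sup>2)"
    using assms by (simp add: L2_def integrable_restrict_space set_integrable_def)
  then have "integrable (lebesgue_on {l..u}) g"
    using assms by (simp add: L2_def square_integrable_imp_integrable[of g])
  then show ?thesis
    by (simp add: integrable_restrict_space set_integrable_def)
qed

lemma one_plus_sq_neq0: "1 + (x::real)\<^sup>2 \<noteq> 0"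
  by (metis add_pos_nonneg less_irrefl zero_le_power2 zero_less_one)

lemma coefficients_integrable:
  assumes "l < u" "f \<in> W22 l u"
  shows "set_integrable lebesgue {l..u}
           (\<lambda>x. 2 * \<gamma> * D2 l u f x / (1 + (D1 l u f x)\<^sup>2) powr (5/2))" (is ?A)
    and "set_integrable lebesgue {l..u}
           (\<lambda>x. D1 l u f x / sqrt (1 + (D1 l u f x)\<^sup>2)
              - 5 * \<gamma> * (D2 l u f x)\<^sup>2 * D1 l u f x / (1 + (D1 l u f x)\<^sup>2) powr (7/2))" (is ?B)
    and "set_integrable lebesgue {l..u}
           (\<lambda>x. sqrt (1 + (D1 l u f x)\<^sup>2)
              + \<gamma> * (D2 l u f x)\<^sup>2 / (1 + (D1 l u f x)\<^sup>2) powr (5/2))" (is ?C)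
proof -
  have D1: "continuous_on {l..u} (D1 l u f)"
    using D1_has_derivative(1) assms by (auto simp: W22_def)
  have D2: "set_integrable lebesgue {l..u} (D2 l u f)"
      "set_integrable lebesgue {l..u} (\<lambda>x. (D2 l u f x)\<^sup>2)"
    using L2_set_integrable[OF D2_weak_deriv(1)[OF assms(2)]] D2_weak_deriv(1)[OF assms(2)]
    by (simp_all only: L2_def mem_Collect_eq)
  have w: "continuous_on {l..u} (\<lambda>x. (1 + (D1 l u f x)\<^sup>2) powr p)" for p :: real
    by (intro continuous_on_powr continuous_on_add continuous_on_power continuous_on_const D1)
      (simp add: one_plus_sq_neq0)
  have s: "continuous_on {l..u} (\<lambda>x. sqrt (1 + (D1 l u f x)\<^sup>2))"
    by (intro continuous_on_real_sqrt continuous_on_add continuous_on_power continuous_on_const D1)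
  have div: "continuous_on {l..u} (\<lambda>x. g x / (1 + (D1 l u f x)\<^sup>2) powr p)"
    if "continuous_on {l..u} g" for g and p :: real
    by (rule continuous_on_divide[OF that w]) (simp add: one_plus_sq_neq0)
  have "continuous_on {l..u} (\<lambda>x. D1 l u f x / sqrt (1 + (D1 l u f x)\<^sup>2))"
    by (rule continuous_on_divide[OF D1 s]) (simp add: one_plus_sq_neq0)
  note B1 = continuous_set_integrable[OF this]
  have B2: "continuous_on {l..u} (\<lambda>x. 5 * \<gamma> * D1 l u f x)"
    by (rule continuous_on_mult[OF continuous_on_const D1])
  show ?A
    using continuous_mult_integrable[OF div[OF continuous_on_const] D2(1), of "2 * \<gamma>" "5/2"]
    by simp
  show ?B
    using set_integral_diff(1)[OF B1 continuous_mult_integrable[OF div[OF B2] D2(2), of "7/2"]]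
    by (simp add: mult_ac)
  show ?C
    using set_integral_add(1)[OF continuous_set_integrable[OF s]
        continuous_mult_integrable[OF div[OF continuous_on_const] D2(2), of \<gamma> "5/2"]]
    by simp
qed

lemma J_integrand:
  "(1 + \<gamma> * (curvature l u f x)\<^sup>2) * sqrt (1 + (D1 l u f x)\<^sup>2) =
   sqrt (1 + (D1 l u f x)\<^sup>2) + \<gamma> * (D2 l u f x)\<^sup>2 / (1 + (D1 l u f x)\<^sup>2) powr (5/2)"
proof -
  define q where "q = 1 + (D1 l u f x)\<^sup>2"
  have q: "q > 0" unfolding q_def by (simp add: add_pos_nonneg)
  have "(q powr (3/2))\<^sup>2 = q powr 3"
    by (simp add: power2_eq_square flip: powr_add)
  moreover have "q powr 3 = q powr (5/2) * sqrt q"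
    using q by (simp add: powr_half_sqrt[symmetric] flip: powr_add)
  ultimately have "(curvature l u f x)\<^sup>2 = (D2 l u f x)\<^sup>2 / (q powr (5/2) * sqrt q)"
    by (simp add: curvature_def power_divide flip: q_def)
  then have "\<gamma> * (curvature l u f x)\<^sup>2 * sqrt q = \<gamma> * (D2 l u f x)\<^sup>2 / q powr (5/2)"
    using q by simp
  then show ?thesis
    unfolding q_def[symmetric] by (simp only: distrib_right mult_1)
qed

end

(* Adding a test function phi of mean zero keeps f admissible, so the one-sided derivative of
   t |-> J (f + t phi) at t = 0, computed by dominated convergence, is nonnegative; applied to phi
   and -phi this shows that the first variation vanishes on test functions of mean zero, hence is a
   multiple of the mean.  Since the second derivative in J is an arbitrarily chosen weak one, its
   uniqueness up to null sets is needed to compute it for f + t phi; this comes from smooth bumps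
   that converge boundedly to indicators of intervals. *)

theory Submission
  imports Defs
begin

subsection \<open>Smooth functions\<close>

text \<open>The obstacle to dominated convergence is that the second derivative \<open>q\<close> is
  merely square integrable while the integrand is quadratic in it, so the difference quotients have
  no constant bound. The mean value theorem bounds them by a constant plus a multiple of
  \<open>q\<^sup>2\<close>, uniformly in the slope \<open>p\<close>, because the powers of
  \<open>1 + p\<^sup>2\<close> in the denominators outweigh the factor \<open>p\<close>. The
  Euler-Lagrange equation itself requires no integration by parts against the minimizer: two
  distributional derivatives on the first coefficient give the sign plus, and the minus sign in
  front of the second term cancels that of its single derivative. The left-hand side at
  \<open>\<phi>\<close> is therefore the first variation in direction \<open>\<phi>\<close> plus
  lambda times the mean of \<open>\<phi>\<close>. Integration by parts is needed only between test
  functions, to see that their classical derivatives are weak ones. What remains is linear algebra: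
  a functional that vanishes on the kernel of another one is a multiple of it.\<close>

definition smooth :: "(real \<Rightarrow> real) \<Rightarrow> bool" where
  "smooth f \<longleftrightarrow> (\<forall>n x. (deriv ^^ n) f field_differentiable (at x))"

text \<open>A class of functions closed under differentiation contains all iterated derivatives of
  its members. Choosing a suitable class \<open>P\<close> replaces explicit formulas for derivatives
  of order n, such as the Leibniz rule.\<close>

lemma smooth_coinduct:
  assumes "P f"
    and step: "\<And>f. P f \<Longrightarrow> \<exists>g. (\<forall>x. (f has_real_derivative g x) (at x)) \<and> P g"
  shows "smooth f"
proof -
  have deriv: "(\<forall>x. f field_differentiable at x) \<and> P (deriv f)" if f: "P f" for f
  proof -
    obtain g where g: "\<And>x. (f has_real_derivative g x) (at x)" "P g"
      using step[OF f] by blast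
    moreover have "deriv f = g"
      using g(1) by (auto intro: DERIV_imp_deriv)
    ultimately show ?thesis
      by (auto simp: field_differentiable_def)
  qed
  have "P ((deriv ^^ n) f)" for n
    by (induction n) (use assms(1) deriv in auto)
  with deriv show ?thesis
    by (auto simp: smooth_def)
qed

lemma smooth_has_derivative:
  "smooth f \<Longrightarrow> (f has_real_derivative deriv f x) (at x)"
  unfolding smooth_def
  using DERIV_deriv_iff_field_differentiable funpow_0 by metis

lemma smooth_funpow_deriv: "smooth f \<Longrightarrow> smooth ((deriv ^^ k) f)"
  unfolding smooth_def by (metis comp_apply funpow_add)

lemma smooth_deriv: "smooth f \<Longrightarrow> smooth (deriv f)"
  using smooth_funpow_deriv[of f 1] by simp

lemma smooth_continuous_on: "smooth f \<Longrightarrow> continuous_on S f"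
  by (meson DERIV_isCont continuous_at_imp_continuous_on smooth_has_derivative)

lemma smooth_add:
  assumes "smooth f" "smooth g"
  shows "smooth (\<lambda>x. f x + g x)"
proof (rule smooth_coinduct[where P = "\<lambda>h. \<exists>f g. smooth f \<and> smooth g \<and> h = (\<lambda>x. f x + g x)"])
  fix h :: "real \<Rightarrow> real"
  assume "\<exists>f g. smooth f \<and> smooth g \<and> h = (\<lambda>x. f x + g x)"
  then obtain f g where fg: "smooth f" "smooth g" and h: "h = (\<lambda>x. f x + g x)" by blast
  have "(h has_real_derivative deriv f x + deriv g x) (at x)" for x
    unfolding h by (rule DERIV_add[OF fg[THEN smooth_has_derivative]])
  then show "\<exists>h'. (\<forall>x. (h has_real_derivative h' x) (at x)) \<and>
      (\<exists>f g. smooth f \<and> smooth g \<and> h' = (\<lambda>x. f x + g x))"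
    using fg[THEN smooth_deriv] by (intro exI[of _ "\<lambda>x. deriv f x + deriv g x"]) blast
qed (use assms in blast)

lemma smooth_affine:
  assumes "smooth f"
  shows "smooth (\<lambda>x. c * f (m * x + b))"
\<comment> \<open>The factor \<open>c\<close> has to vary in the invariant, since each
  differentiation multiplies it by \<open>m\<close>; \<open>m\<close> and \<open>b\<close> stay
  fixed.\<close>
proof (rule smooth_coinduct[where P = "\<lambda>h. \<exists>c f. smooth f \<and> h = (\<lambda>x. c * f (m * x + b))"])
  fix h :: "real \<Rightarrow> real"
  assume "\<exists>c f. smooth f \<and> h = (\<lambda>x. c * f (m * x + b))"
  then obtain c f where f: "smooth f" and h: "h = (\<lambda>x. c * f (m * x + b))" by blast
  have "((\<lambda>x. m * x + b) has_real_derivative m) (at x)" for x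
    by (auto intro!: derivative_eq_intros)
  from DERIV_cmult[OF DERIV_chain2[OF smooth_has_derivative[OF f] this], of c]
  have "(h has_real_derivative c * m * deriv f (m * x + b)) (at x)" for x
    unfolding h by (simp only: mult.assoc mult.commute[of m "deriv f y" for y])
  then show "\<exists>h'. (\<forall>x. (h has_real_derivative h' x) (at x)) \<and>
      (\<exists>c f. smooth f \<and> h' = (\<lambda>x. c * f (m * x + b)))"
    using smooth_deriv[OF f] by (intro exI[of _ "\<lambda>x. c * m * deriv f (m * x + b)"]) blast
qed (use assms in blast)

lemma smooth_scale: "smooth f \<Longrightarrow> smooth (\<lambda>x. c * f x)"
  using smooth_affine[of f c 1 0] by simp

text \<open>A coinduction invariant for products: unlike the single products it is closed under
  differentiation.\<close>

inductive smooth_sum_of_products :: "(real \<Rightarrow> real) \<Rightarrow> bool" where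
  product: "smooth f \<Longrightarrow> smooth g \<Longrightarrow> smooth_sum_of_products (\<lambda>x. f x * g x)"
| sum: "smooth_sum_of_products h \<Longrightarrow> smooth_sum_of_products k \<Longrightarrow>
    smooth_sum_of_products (\<lambda>x. h x + k x)"

lemma smooth_mult:
  assumes "smooth f" "smooth g"
  shows "smooth (\<lambda>x. f x * g x)"
proof (rule smooth_coinduct[where P = smooth_sum_of_products])
  fix h :: "real \<Rightarrow> real"
  assume "smooth_sum_of_products h"
  then show "\<exists>h'. (\<forall>x. (h has_real_derivative h' x) (at x)) \<and> smooth_sum_of_products h'"
  proof induction
    case (product f g)
    have "((\<lambda>x. f x * g x) has_real_derivative deriv f x * g x + deriv g x * f x) (at x)" for x
      by (rule DERIV_mult[OF product[THEN smooth_has_derivative]])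
    moreover have "smooth_sum_of_products (\<lambda>x. deriv f x * g x + deriv g x * f x)"
      by (intro smooth_sum_of_products.intros smooth_deriv product)
    ultimately show ?case
      by (intro exI[of _ "\<lambda>x. deriv f x * g x + deriv g x * f x"]) simp
  next
    case (sum h k)
    then obtain h' k' where
      "\<And>x. (h has_real_derivative h' x) (at x)" "smooth_sum_of_products h'"
      "\<And>x. (k has_real_derivative k' x) (at x)" "smooth_sum_of_products k'"
      by blast
    then show ?case
      by (intro exI[of _ "\<lambda>x. h' x + k' x"]) (auto intro: DERIV_add smooth_sum_of_products.intros)
  qed
qed (use assms in \<open>auto intro: product\<close>)

section \<open>Functions flat at the origin\<close>

text \<open>For \<open>p = 1\<close> this is the classical smooth function that is not analytic at
  0. A polynomial in \<open>1 / x\<close> is allowed as a factor because differentiation produces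
  one, so that the family is closed under it.\<close>

definition flat :: "real poly \<Rightarrow> real \<Rightarrow> real" where
  "flat p x = (if x > 0 then poly p (1 / x) * exp (- 1 / x) else 0)"

lemma poly_times_exp_neg_tendsto_0:
  "((\<lambda>y::real. poly p y * exp (- y)) \<longlongrightarrow> 0) at_top"
proof -
  have "((\<lambda>y. \<Sum>i\<le>degree p. coeff p i * (y ^ i / exp y)) \<longlongrightarrow> (\<Sum>i\<le>degree p. coeff p i * 0)) at_top"
    by (intro tendsto_intros tendsto_power_div_exp_0)
  then show ?thesis
    by (simp add: poly_altdef sum_distrib_right exp_minus divide_inverse mult.assoc)
qed

lemma flat_tendsto_0: "(flat p \<longlongrightarrow> 0) (at 0)"
proof -
  have "((\<lambda>x. poly p (inverse x) * exp (- inverse x)) \<longlongrightarrow> 0) (at_right 0)"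
    by (rule filterlim_compose[OF poly_times_exp_neg_tendsto_0 filterlim_inverse_at_top_right])
  then have "(flat p \<longlongrightarrow> 0) (at_right 0)"
    by (rule Lim_transform_eventually)
      (auto simp: flat_def eventually_at_filter divide_inverse)
  moreover have "(flat p \<longlongrightarrow> 0) (at_left 0)"
    by (rule Lim_transform_eventually[OF tendsto_const])
      (auto simp: flat_def eventually_at_filter)
  ultimately show ?thesis
    by (simp add: filterlim_split_at)
qed

text \<open>For positive x, both factors contribute the inner derivative of \<open>1 / x\<close>,
  which gives \<open>(p - p') (1 / x) / x\<^sup>2\<close> times the exponential; as a polynomial in
  \<open>y = 1 / x\<close> the new factor is \<open>y\<^sup>2 * (p - p')\<close>.\<close>

lemma flat_has_derivative:
  "(flat p has_real_derivative flat (monom 1 2 * (p - pderiv p)) x) (at x)"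
proof (cases x "0 :: real" rule: linorder_cases)
  case less
  have "\<forall>\<^sub>F y in nhds x. flat p y = 0"
    using eventually_nhds_in_open[of "{..<0}" x] less
    by (auto simp: flat_def intro: eventually_mono[of "\<lambda>y. y < 0"])
  then have "(flat p has_real_derivative 0) (at x)"
    by (subst DERIV_cong_ev[OF refl _ refl]) auto
  with less show ?thesis by (simp add: flat_def)
next
  case equal
  \<comment> \<open>Dividing by h multiplies the polynomial in \<open>1 / h\<close> by its variable,
    so the difference quotient at 0 is again a flat function and tends to 0.\<close>
  have "((\<lambda>h. (flat p (0 + h) - flat p 0) / h) \<longlongrightarrow> 0) (at 0)"
    by (rule Lim_transform_eventually[OF flat_tendsto_0[of "monom 1 1 * p"]])
      (auto simp: flat_def eventually_at_filter poly_monom)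
  with equal show ?thesis by (simp add: DERIV_def flat_def)
next
  case greater
  have inv: "((\<lambda>x. 1 / x) has_real_derivative - (1 / x\<^sup>2)) (at x)"
    using greater by (auto intro!: derivative_eq_intros simp: power2_eq_square)
  have exp: "((\<lambda>x. exp (- (1 / x))) has_real_derivative exp (- (1 / x)) * (1 / x\<^sup>2)) (at x)"
    using DERIV_chain2[OF DERIV_exp DERIV_minus[OF inv]] by simp
  have "((\<lambda>x. poly p (1 / x) * exp (- (1 / x))) has_real_derivative
      flat (monom 1 2 * (p - pderiv p)) x) (at x)"
    using DERIV_mult[OF DERIV_chain2[OF poly_DERIV inv] exp] greater
    by (simp add: flat_def poly_monom power_one_over algebra_simps)
  moreover have "\<forall>\<^sub>F y in nhds x. flat p y = poly p (1 / y) * exp (- (1 / y))"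
    using eventually_nhds_in_open[of "{0<..}" x] greater
    by (auto simp: flat_def intro: eventually_mono[of "\<lambda>y. y > 0"])
  ultimately show ?thesis
    by (subst DERIV_cong_ev[OF refl _ refl])
qed

lemma smooth_flat: "smooth (flat p)"
  by (rule smooth_coinduct[where P = "\<lambda>h. \<exists>p. h = flat p"]) (use flat_has_derivative in blast)+

subsection \<open>Test functions\<close>

lemma compact_of_subset_box:
  fixes l u :: real
  shows "closed S \<Longrightarrow> S \<subseteq> {l<..<u} \<Longrightarrow> compact S"
  by (metis bounded_subset bounded_box box_real(1) compact_eq_bounded_closed)

lemma test_function_iff:
  "test_function l u \<phi> \<longleftrightarrow> smooth \<phi> \<and> closure {x. \<phi> x \<noteq> 0} \<subseteq> {l<..<u}"
  using compact_of_subset_box[OF closed_closure, of "{x. \<phi> x \<noteq> 0}" l u]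
  unfolding test_function_def smooth_def by argo

lemma test_function_smooth: "test_function l u \<phi> \<Longrightarrow> smooth \<phi>"
  by (simp add: test_function_iff)

lemma test_function_outside: "test_function l u \<phi> \<Longrightarrow> x \<notin> {l<..<u} \<Longrightarrow> \<phi> x = 0"
  using subsetD[OF closure_subset[of "{x. \<phi> x \<noteq> 0}"], of x]
  unfolding test_function_iff by (cases "\<phi> x = 0") (simp_all add: subset_eq)

lemma test_function_add:
  assumes "test_function l u \<phi>" "test_function l u \<psi>"
  shows "test_function l u (\<lambda>x. \<phi> x + \<psi> x)"
proof -
  have "closure {x. \<phi> x + \<psi> x \<noteq> 0} \<subseteq> closure ({x. \<phi> x \<noteq> 0} \<union> {x. \<psi> x \<noteq> 0})"
    by (intro closure_mono) auto
  also have "\<dots> \<subseteq> {l<..<u}"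
    using assms by (simp only: closure_Un test_function_iff Un_least)
  finally show ?thesis
    using assms by (simp only: test_function_iff smooth_add simp_thms)
qed

text \<open>The inclusion is into the closure, not into the set where \<open>\<phi>\<close> is
  nonzero, so that it applies to derivatives: at a simple zero of \<open>\<phi>\<close> its
  derivative does not vanish.\<close>

lemma test_function_of_support:
  assumes "test_function l u \<phi>" "smooth \<psi>" "{x. \<psi> x \<noteq> 0} \<subseteq> closure {x. \<phi> x \<noteq> 0}"
  shows "test_function l u \<psi>"
  using assms(1,2) order_trans[OF closure_minimal[OF assms(3) closed_closure]]
  unfolding test_function_iff by (elim conjE) (intro conjI)

lemma test_function_mult:
  assumes "test_function l u \<phi>" "smooth \<psi>"
  shows "test_function l u (\<lambda>x. \<psi> x * \<phi> x)"
proof (rule test_function_of_support[OF assms(1)])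
  show "{x. \<psi> x * \<phi> x \<noteq> 0} \<subseteq> closure {x. \<phi> x \<noteq> 0}"
    by (rule order_trans[OF _ closure_subset]) auto
qed (intro smooth_mult assms(2) test_function_smooth[OF assms(1)])

lemma test_function_scale:
  assumes "test_function l u \<phi>"
  shows "test_function l u (\<lambda>x. c * \<phi> x)"
proof (rule test_function_of_support[OF assms])
  show "{x. c * \<phi> x \<noteq> 0} \<subseteq> closure {x. \<phi> x \<noteq> 0}"
    by (rule order_trans[OF _ closure_subset]) auto
qed (intro smooth_scale test_function_smooth[OF assms])

lemma test_function_deriv:
  assumes "test_function l u \<phi>"
  shows "test_function l u (deriv \<phi>)"
proof (rule test_function_of_support[OF assms])
  let ?S = "closure {x. \<phi> x \<noteq> 0}"
  have "deriv \<phi> x = 0" if "x \<in> - ?S" for x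
  proof -
    have outside: "\<phi> y = 0" if "y \<in> - ?S" for y
      using that subsetD[OF closure_subset[of "{x. \<phi> x \<noteq> 0}"], of y] by (cases "\<phi> y = 0") simp_all
    have "\<forall>\<^sub>F y in nhds x. y \<in> - ?S"
      using that by (intro eventually_nhds_in_open) (simp_all only: open_Compl closed_closure)
    then have "\<forall>\<^sub>F y in nhds x. \<phi> y = 0"
      by (rule eventually_mono) (rule outside)
    then have "deriv \<phi> x = deriv (\<lambda>_. 0) x"
      by (intro deriv_cong_ev refl)
    then show ?thesis by simp
  qed
  then show "{x. deriv \<phi> x \<noteq> 0} \<subseteq> ?S"
    by (intro subsetI) (rule ccontr, simp)
qed (intro smooth_deriv test_function_smooth[OF assms])

lemma test_function_funpow_deriv:
  "test_function l u \<phi> \<Longrightarrow> test_function l u ((deriv ^^ k) \<phi>)"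
  by (induction k) (auto intro: test_function_deriv)

text \<open>Weak derivatives and regular distributions integrate over the open interval, whereas
  \<open>J\<close> and the integrability facts concern the closed one. A test function vanishes at
  the endpoints, so the two integrands agree everywhere, for an arbitrary \<open>g\<close>.\<close>

lemma test_integral_Icc:
  assumes "test_function l u \<phi>"
  shows "(LINT x:{l<..<u}|lebesgue. g x * \<phi> x) = (LINT x:{l..u}|lebesgue. g x * \<phi> x)"
proof -
  have "indicat_real {l<..<u} x *\<^sub>R (g x * \<phi> x) = indicat_real {l..u} x *\<^sub>R (g x * \<phi> x)" for x
    using test_function_outside[OF assms, of x] by (auto simp: indicator_def)
  then show ?thesis
    by (simp only: set_lebesgue_integral_def)
qed

lemma integral_test_deriv:
  assumes "l < u" "test_function l u \<phi>"
  shows "(LINT x:{l..u}|lebesgue. deriv \<phi> x) = 0"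
proof -
  have "(deriv \<phi> has_integral \<phi> u - \<phi> l) {l..u}"
    using assms(1) DERIV_subset[OF smooth_has_derivative[OF test_function_smooth[OF assms(2)]]]
    by (intro fundamental_theorem_of_calculus)
      (simp_all add: has_real_derivative_iff_has_vector_derivative[symmetric])
  then have "integral {l..u} (deriv \<phi>) = 0"
    using test_function_outside[OF assms(2)] by (simp add: integral_unique)
  moreover have "set_integrable lebesgue {l..u} (deriv \<phi>)"
    using test_function_smooth[OF assms(2)]
    by (intro continuous_set_integrable smooth_continuous_on smooth_deriv)
  ultimately show ?thesis
    by (simp add: set_lebesgue_integral_eq_integral)
qed

lemma test_integral_by_parts:
  assumes "l < u" "test_function l u \<phi>" "test_function l u \<psi>"
  shows "(LINT x:{l..u}|lebesgue. \<phi> x * deriv \<psi> x) = - (LINT x:{l..u}|lebesgue. deriv \<phi> x * \<psi> x)"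
proof -
  note sm = assms(2,3)[THEN test_function_smooth]
  have "deriv (\<lambda>x. \<phi> x * \<psi> x) = (\<lambda>x. \<phi> x * deriv \<psi> x + deriv \<phi> x * \<psi> x)"
    using DERIV_mult[OF sm[THEN smooth_has_derivative]]
    by (intro ext DERIV_imp_deriv) (simp add: add.commute mult.commute)
  then have "(LINT x:{l..u}|lebesgue. \<phi> x * deriv \<psi> x + deriv \<phi> x * \<psi> x) = 0"
    using integral_test_deriv[OF assms(1) test_function_mult[OF assms(3) sm(1)]] by simp
  moreover have "set_integrable lebesgue {l..u} (\<lambda>x. \<phi> x * deriv \<psi> x)"
    "set_integrable lebesgue {l..u} (\<lambda>x. deriv \<phi> x * \<psi> x)"
    by (intro continuous_set_integrable smooth_continuous_on smooth_mult smooth_deriv sm)+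
  ultimately show ?thesis
    by (simp add: set_integral_add)
qed

text \<open>One derivative at a time moves to \<open>\<phi>\<close>, which therefore varies in the
  induction. The result says that the classical derivatives of a test function are weak
  derivatives.\<close>

lemma test_integral_by_parts_funpow:
  assumes "l < u" "test_function l u \<phi>" "test_function l u \<psi>"
  shows "(LINT x:{l..u}|lebesgue. \<phi> x * (deriv ^^ k) \<psi> x) =
    (- 1) ^ k * (LINT x:{l..u}|lebesgue. (deriv ^^ k) \<phi> x * \<psi> x)"
  using assms(2)
proof (induction k arbitrary: \<phi>)
  case (Suc k)
  have "(LINT x:{l..u}|lebesgue. \<phi> x * (deriv ^^ Suc k) \<psi> x) =
      - (LINT x:{l..u}|lebesgue. deriv \<phi> x * (deriv ^^ k) \<psi> x)"
    using test_integral_by_parts[OF assms(1) Suc.prems test_function_funpow_deriv[OF assms(3)]]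
    by simp
  also have "\<dots> = - ((- 1) ^ k * (LINT x:{l..u}|lebesgue. (deriv ^^ k) (deriv \<phi>) x * \<psi> x))"
    by (subst Suc.IH[OF test_function_deriv[OF Suc.prems]]) simp
  finally show ?case
    by (simp add: funpow_swap1[of deriv])
qed simp

subsection \<open>Weak derivatives\<close>

lemma continuous_in_L2:
  assumes "continuous_on {l..u} g"
  shows "g \<in> L2 l u"
  unfolding L2_def
  using assms by (auto intro!: continuous_imp_measurable_on_sets_lebesgue continuous_set_integrable
      continuous_on_power)

lemma L2_add:
  assumes "g \<in> L2 l u" "h \<in> L2 l u"
  shows "(\<lambda>x. g x + h x) \<in> L2 l u"
proof -
  have [measurable]: "g \<in> borel_measurable (lebesgue_on {l..u})"
    "h \<in> borel_measurable (lebesgue_on {l..u})"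
    using assms by (auto simp: L2_def)
  have int: "integrable (lebesgue_on {l..u}) (\<lambda>x. 2 * (g x)\<^sup>2 + 2 * (h x)\<^sup>2)"
    using assms by (auto simp: L2_def set_integrable_eq)
  have "(g x + h x)\<^sup>2 \<le> 2 * (g x)\<^sup>2 + 2 * (h x)\<^sup>2" for x
    using sum_squares_bound[of "g x" "h x"] by (simp add: power2_sum)
  then have "norm ((g x + h x)\<^sup>2) \<le> norm (2 * (g x)\<^sup>2 + 2 * (h x)\<^sup>2)" for x
    by simp
  then have "integrable (lebesgue_on {l..u}) (\<lambda>x. (g x + h x)\<^sup>2)"
    by (intro Bochner_Integration.integrable_bound[OF int]) auto
  then show ?thesis
    by (simp add: L2_def set_integrable_eq)
qed

lemma set_integrable_locally_integrable:
  "set_integrable lebesgue {l..u} g \<Longrightarrow> locally_integrable l u g"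
  unfolding locally_integrable_def
  by (metis compact_imp_closed greaterThanLessThan_subseteq_atLeastAtMost_iff lmeasurable_compact
      fmeasurableD order_refl set_integrable_subset subset_trans)

text \<open>The defining identity is additive once the integrals split. Splitting requires every
  product with a test function to be integrable, since a non-integrable one would have integral 0 by
  default; membership in \<open>L2\<close> ensures this.\<close>

lemma has_weak_deriv_add_test:
  assumes "l < u" "f \<in> L2 l u" "g \<in> L2 l u" "has_weak_deriv k l u f g" "test_function l u \<phi>"
  shows "has_weak_deriv k l u (\<lambda>x. f x + \<phi> x) (\<lambda>x. g x + (deriv ^^ k) \<phi> x)"
proof -
  note test = test_function_funpow_deriv[of l u _ k]
  have cont: "continuous_on S \<psi>" if "test_function l u \<psi>" for \<psi> S
    using that by (intro smooth_continuous_on test_function_smooth)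
  have int: "set_integrable lebesgue {l..u} (\<lambda>x. h x * \<psi> x)"
    if "h \<in> L2 l u" "test_function l u \<psi>" for h \<psi>
    using continuous_mult_integrable[OF cont[OF that(2)] L2_set_integrable[OF that(1)]]
    by (simp add: mult.commute)
  have L2: "\<psi> \<in> L2 l u" if "test_function l u \<psi>" for \<psi>
    using that by (intro continuous_in_L2 cont)
  have "(LINT x:{l<..<u}|lebesgue. (f x + \<phi> x) * (deriv ^^ k) \<psi> x) =
      (- 1) ^ k * (LINT x:{l<..<u}|lebesgue. (g x + (deriv ^^ k) \<phi> x) * \<psi> x)"
    if \<psi>: "test_function l u \<psi>" for \<psi>
  proof -
    have "(LINT x:{l..u}|lebesgue. f x * (deriv ^^ k) \<psi> x) =
        (- 1) ^ k * (LINT x:{l..u}|lebesgue. g x * \<psi> x)"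
      using assms(4) \<psi> by (simp add: has_weak_deriv_def test_integral_Icc test)
    then show ?thesis
      unfolding test_integral_Icc[OF \<psi>] test_integral_Icc[OF test[OF \<psi>]]
      using test_integral_by_parts_funpow[OF assms(1,5) \<psi>, of k]
      by (simp add: \<psi> test distrib_right set_integral_add int assms L2 distrib_left)
  qed
  then show ?thesis
    unfolding has_weak_deriv_def
    by (intro conjI allI impI set_integrable_locally_integrable L2_set_integrable L2_add L2 test
        assms)
qed

section \<open>Fundamental lemma of the calculus of variations and uniqueness of weak
  derivatives\<close>

lemma integral_Ioo_zero_if_orthogonal_to_tests:
  assumes "l \<le> c" "d \<le> u" "set_integrable lebesgue {l..u} g"
    and test: "\<And>\<phi>. test_function l u \<phi> \<Longrightarrow> (LINT x:{l..u}|lebesgue. g x * \<phi> x) = 0"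
  shows "(LINT x:{c<..<d}|lebesgue. g x) = 0"
proof -
  define e where "e = flat 1"
  have e: "0 \<le> e x" "e x \<le> 1" "x \<le> 0 \<Longrightarrow> e x = 0" for x
    by (auto simp: e_def flat_def)
  \<comment> \<open>The arguments are \<open>n * (x - c) - 1\<close> and
    \<open>n * (d - x) - 1\<close>. The shift by 1 makes the product vanish within distance
    \<open>1 / n\<close> of \<open>c\<close> and \<open>d\<close>, so that the closed support stays
    in the open interval even when \<open>c = l\<close> or \<open>d = u\<close>. At a fixed point
    between \<open>c\<close> and \<open>d\<close> both arguments tend to infinity, where
    \<open>e\<close> tends to 1.\<close>
  define \<psi> where "\<psi> n x = e (real n * x + (- real n * c - 1)) * e (- real n * x + (real n * d - 1))"
    for n :: nat and x
  have smooth: "smooth (\<psi> n)" for n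
  proof -
    have "smooth (\<lambda>x. e (m * x + b))" for m b
      using smooth_affine[OF smooth_flat, of 1 1 m b] by (simp add: e_def)
    then show ?thesis
      unfolding \<psi>_def by (intro smooth_mult)
  qed
  have lim1: "(\<lambda>n. e (real n * y - 1)) \<longlonglongrightarrow> indicat_real {0<..} y" for y
  proof (cases "y > 0")
    case True
    have top: "filterlim (\<lambda>n. real n * y - 1) at_top sequentially"
    proof -
      have "filterlim (\<lambda>n. - 1 + y * real n) at_top sequentially"
        using True
        by (intro filterlim_tendsto_add_at_top[OF tendsto_const]
            filterlim_tendsto_pos_mult_at_top[OF tendsto_const] filterlim_real_sequentially)
      then show ?thesis by (simp add: algebra_simps)
    qed
    have "(\<lambda>n. exp (- inverse (real n * y - 1))) \<longlonglongrightarrow> exp (- 0)"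
      by (intro tendsto_exp tendsto_minus tendsto_inverse_0_at_top top)
    moreover have "\<forall>\<^sub>F n in sequentially. 0 < real n * y - 1"
      using top unfolding filterlim_at_top_dense by (rule spec)
    then have "\<forall>\<^sub>F n in sequentially. exp (- inverse (real n * y - 1)) = e (real n * y - 1)"
      by eventually_elim (simp add: e_def flat_def divide_inverse)
    ultimately have "(\<lambda>n. e (real n * y - 1)) \<longlonglongrightarrow> exp (- 0)"
      by (rule Lim_transform_eventually)
    with True show ?thesis by simp
  next
    case False
    then have "e (real n * y - 1) = 0" for n
      using mult_nonneg_nonpos[of "real n" y] by (intro e(3)) simp
    with False show ?thesis by simp
  qed
  have lim: "(\<lambda>n. \<psi> n x) \<longlonglongrightarrow> indicat_real {c<..<d} x" for x
  proof -
    have "\<psi> n x = e (real n * (x - c) - 1) * e (real n * (d - x) - 1)" for n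
      by (simp add: \<psi>_def algebra_simps)
    moreover have "indicat_real {c<..<d} x = indicat_real {0<..} (x - c) * indicat_real {0<..} (d - x)"
      by (simp add: indicator_def)
    ultimately show ?thesis
      using tendsto_mult[OF lim1 lim1] by simp
  qed
  \<comment> \<open>The index starts at 1 because the margin \<open>1 / n\<close> has to be
    positive; at \<open>n = 0\<close> it would be 0 by the convention for division.\<close>
  have zero: "(LINT x:{l..u}|lebesgue. g x * \<psi> (Suc n) x) = 0" for n
  proof (rule test)
    let ?n = "real (Suc n)"
    have "{x. \<psi> (Suc n) x \<noteq> 0} \<subseteq> {c + 1 / ?n .. d - 1 / ?n}"
    proof
      fix x assume "x \<in> {x. \<psi> (Suc n) x \<noteq> 0}"
      then have "?n * x + (- ?n * c - 1) > 0" "- ?n * x + (?n * d - 1) > 0"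
        using e(3) by (force simp: \<psi>_def not_le[symmetric])+
      then show "x \<in> {c + 1 / ?n .. d - 1 / ?n}"
        by (simp add: field_simps)
    qed
    then have "closure {x. \<psi> (Suc n) x \<noteq> 0} \<subseteq> {c + 1 / ?n .. d - 1 / ?n}"
      by (rule closure_minimal) simp
    also have "\<dots> \<subseteq> {l<..<u}"
    proof
      fix x assume "x \<in> {c + 1 / ?n .. d - 1 / ?n}"
      moreover have "1 / ?n > 0" by simp
      ultimately show "x \<in> {l<..<u}"
        using assms(1,2) unfolding atLeastAtMost_iff greaterThanLessThan_iff by linarith
    qed
    finally have supp: "closure {x. \<psi> (Suc n) x \<noteq> 0} \<subseteq> {l<..<u}" .
    with smooth show "test_function l u (\<psi> (Suc n))"
      unfolding test_function_iff by (rule_tac conjI)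
  qed
  have g: "integrable lebesgue (\<lambda>x. indicator {l..u} x * g x)"
    using assms(3) by (simp add: set_integrable_def)
  have \<psi>_meas: "\<psi> n \<in> borel_measurable lebesgue" for n
    using borel_measurable_continuous_onI[OF smooth_continuous_on[OF smooth]]
    by (intro measurable_completion) simp
  have "(\<lambda>n. LINT x|lebesgue. indicator {l..u} x * g x * \<psi> (Suc n) x) \<longlonglongrightarrow>
      (LINT x|lebesgue. indicator {l..u} x * g x * indicator {c<..<d} x)"
  proof (rule integral_dominated_convergence[where w = "\<lambda>x. norm (indicator {l..u} x * g x)"])
    have "norm (\<psi> n x) \<le> 1" for n x
      using e(1,2) by (simp add: \<psi>_def abs_mult mult_le_one)
    then show "AE x in lebesgue. norm (indicator {l..u} x * g x * \<psi> (Suc n) x)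
        \<le> norm (indicator {l..u} x * g x)" for n
      by (intro AE_I2) (simp only: norm_mult mult_left_le norm_ge_zero mult_nonneg_nonneg)
    show "AE x in lebesgue. (\<lambda>n. indicator {l..u} x * g x * \<psi> (Suc n) x)
        \<longlonglongrightarrow> indicator {l..u} x * g x * indicator {c<..<d} x"
      by (intro AE_I2 tendsto_intros LIMSEQ_Suc lim)
    show "(\<lambda>x. indicator {l..u} x * g x * \<psi> (Suc n) x) \<in> borel_measurable lebesgue" for n
      by (rule borel_measurable_times[OF borel_measurable_integrable[OF g] \<psi>_meas])
    show "(\<lambda>x. indicator {l..u} x * g x * indicator {c<..<d} x) \<in> borel_measurable lebesgue"
      by (rule borel_measurable_times[OF borel_measurable_integrable[OF g] borel_measurable_indicator])
        simp
    show "integrable lebesgue (\<lambda>x. norm (indicator {l..u} x * g x))"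
      by (rule integrable_norm[OF g])
  qed
  then have "(LINT x|lebesgue. indicator {l..u} x * g x * indicator {c<..<d} x) = 0"
    using zero by (simp add: set_lebesgue_integral_def LIMSEQ_const_iff mult.assoc)
  moreover have "indicator {l..u} x * g x * indicator {c<..<d} x = indicat_real {c<..<d} x * g x" for x
    using assms(1,2) by (auto simp: indicator_def)
  ultimately show ?thesis
    by (simp add: set_lebesgue_integral_def)
qed

text \<open>Vanishing integrals over intervals extend to Borel sets, since the closed intervals form
  a generator stable under intersection, and then to Lebesgue sets, which differ from Borel sets by
  null sets. A density whose integral over every measurable set is 0 vanishes almost
  everywhere.\<close>

lemma AE_zero_if_orthogonal_to_tests:
  assumes "set_integrable lebesgue {l..u} g"
    and "\<And>\<phi>. test_function l u \<phi> \<Longrightarrow> (LINT x:{l..u}|lebesgue. g x * \<phi> x) = 0"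
  shows "AE x\<in>{l..u} in lebesgue. g x = 0"
proof -
  \<comment> \<open>Extension by zero makes the integral over every measurable subset of the line
    meaningful, including complements.\<close>
  define G where "G x = indicator {l..u} x * g x" for x
  have int: "integrable lebesgue G"
    using assms(1) by (simp add: set_integrable_def G_def[abs_def])
  then have sint: "set_integrable lebesgue A G" if "A \<in> sets lebesgue" for A
    using that integrable_mult_indicator[OF that int] by (simp add: set_integrable_def)
  have Icc: "(LINT x:{a..b}|lebesgue. G x) = 0" for a b
  proof -
    have "(LINT x:{a..b}|lebesgue. G x) = (LINT x:{a..b} \<inter> {l..u}|lebesgue. g x)"
      by (simp only: set_lebesgue_integral_def G_def indicator_inter_arith real_scaleR_def mult.assoc)
    \<comment> \<open>The closed intersection and the open interval differ at most in the four
      endpoints; either of them may be empty.\<close>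
    also have "\<dots> = (LINT x:{max a l<..<min b u}|lebesgue. g x)"
      by (rule set_integral_discrete_difference[where X = "{a, b, l, u}"]) (auto simp: max_def min_def)
    also have "\<dots> = 0"
      by (rule integral_Ioo_zero_if_orthogonal_to_tests[OF _ _ assms]) auto
    finally show ?thesis .
  qed
  have borel: "(LINT x:A|lebesgue. G x) = 0" if "A \<in> sets borel" for A
    using that
  proof (induction rule: borel_set_induct)
    case (compl A)
    \<comment> \<open>The whole line is not one of the closed intervals, but \<open>G\<close>
      vanishes off \<open>{l..u}\<close>, so its total integral is covered by
      \<open>Icc\<close>.\<close>
    have "(LINT x:A \<union> -A|lebesgue. G x) = (LINT x:A|lebesgue. G x) + (LINT x:-A|lebesgue. G x)"
      using compl by (intro set_integral_Un sint) auto
    moreover have "(LINT x:A \<union> -A|lebesgue. G x) = (LINT x:{l..u}|lebesgue. G x)"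
      unfolding set_lebesgue_integral_def
      by (intro Bochner_Integration.integral_cong refl) (auto simp: G_def split: split_indicator)
    ultimately show ?case
      using compl Icc by simp
  next
    case (union A)
    have "(LINT x:(\<Union>i. A i)|lebesgue. G x) = (\<Sum>i. LINT x:A i|lebesgue. G x)"
      using union by (intro lebesgue_integral_countable_add sint)
        (auto simp: disjoint_family_on_def)
    with union show ?case by simp
  qed (simp_all only: Icc, simp add: set_lebesgue_integral_def)
  have "(LINT x:A|lebesgue. G x) = 0" if "A \<in> sets lebesgue" for A
    using that
  proof (rule sets_completionE)
    fix S N N' :: "real set"
    assume A: "A = S \<union> N" "N \<subseteq> N'" "N' \<in> null_sets lborel" "S \<in> sets lborel"
    have "(LINT x:A|lebesgue. G x) = (LINT x:S|lebesgue. G x)"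
    proof (rule set_integral_cong_set)
      have "AE x in lebesgue. x \<notin> N'"
        using A(3) by (intro AE_not_in null_sets_completionI)
      then show "AE x in lebesgue. (x \<in> S) = (x \<in> A)"
        by eventually_elim (use A in auto)
      show "set_borel_measurable lebesgue A G" "set_borel_measurable lebesgue S G"
        using sint[OF that] sint[of S] A(4)
        by (auto simp: set_integrable_def set_borel_measurable_def dest: borel_measurable_integrable)
    qed
    with borel[of S] A(4) show ?thesis by simp
  qed
  then have "AE x in lebesgue. G x = 0"
    using density_unique_real[OF int integrable_zero] by simp
  then show ?thesis
    by eventually_elim (auto simp: G_def indicator_def)
qed

lemma weak_deriv_unique:
  assumes "g \<in> L2 l u" "h \<in> L2 l u" "has_weak_deriv k l u f g" "has_weak_deriv k l u f h"
  shows "AE x\<in>{l..u} in lebesgue. g x = h x"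
proof -
  have "(LINT x:{l..u}|lebesgue. (g x - h x) * \<phi> x) = 0" if \<phi>: "test_function l u \<phi>" for \<phi>
  proof -
    have "set_integrable lebesgue {l..u} (\<lambda>x. w x * \<phi> x)" if "w \<in> L2 l u" for w
      using continuous_mult_integrable[OF
          smooth_continuous_on[OF test_function_smooth[OF \<phi>]] L2_set_integrable[OF that]]
      by (simp add: mult.commute)
    moreover have "(- 1) ^ k * (LINT x:{l..u}|lebesgue. g x * \<phi> x) =
        (- 1) ^ k * (LINT x:{l..u}|lebesgue. h x * \<phi> x)"
      using assms(3,4) \<phi> by (simp add: has_weak_deriv_def flip: test_integral_Icc)
    ultimately show ?thesis
      using assms(1,2) by (simp add: left_diff_distrib set_integral_diff)
  qed
  then have "AE x\<in>{l..u} in lebesgue. g x - h x = 0"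
    using assms(1,2) by (intro AE_zero_if_orthogonal_to_tests set_integral_diff L2_set_integrable)
  then show ?thesis by simp
qed

subsection \<open>First variation\<close>

text \<open>The integrand of \<open>J\<close> in the expanded form of \<open>J_integrand\<close>,
  with slope \<open>p\<close> and second derivative \<open>q\<close> as independent real variables.
  Its partial derivatives are the coefficients of the Euler-Lagrange equation.\<close>

definition lagrangian :: "real \<Rightarrow> real \<Rightarrow> real \<Rightarrow> real" where
  "lagrangian \<gamma> p q = sqrt (1 + p\<^sup>2) + \<gamma> * q\<^sup>2 / (1 + p\<^sup>2) powr (5/2)"

definition lagrangian_p :: "real \<Rightarrow> real \<Rightarrow> real \<Rightarrow> real" where
  "lagrangian_p \<gamma> p q = p / sqrt (1 + p\<^sup>2) - 5 * \<gamma> * q\<^sup>2 * p / (1 + p\<^sup>2) powr (7/2)"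

definition lagrangian_q :: "real \<Rightarrow> real \<Rightarrow> real \<Rightarrow> real" where
  "lagrangian_q \<gamma> p q = 2 * \<gamma> * q / (1 + p\<^sup>2) powr (5/2)"

lemma lagrangian_has_derivative:
  "((\<lambda>t. lagrangian \<gamma> (p + t * r) (q + t * s)) has_real_derivative
     lagrangian_p \<gamma> (p + t * r) (q + t * s) * r + lagrangian_q \<gamma> (p + t * r) (q + t * s) * s) (at t)"
proof -
  define P where "P t = p + t * r" for t
  define Q where "Q t = q + t * s" for t
  have pos: "0 < 1 + (P t)\<^sup>2"
    by (simp add: add_pos_nonneg)
  have P: "((\<lambda>t. 1 + (P t)\<^sup>2) has_real_derivative 2 * P t * r) (at t)"
    unfolding P_def by (auto intro!: derivative_eq_intros)
  have Q: "((\<lambda>t. \<gamma> * (Q t)\<^sup>2) has_real_derivative 2 * \<gamma> * Q t * s) (at t)"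
    unfolding Q_def by (auto intro!: derivative_eq_intros)
  \<comment> \<open>The quotient is differentiated as a product with a negative power; lowering the
    exponent by 1 gives the power 7/2 in the denominator of \<open>lagrangian_p\<close>.\<close>
  have "((\<lambda>t. (1 + (P t)\<^sup>2) powr (-5/2)) has_real_derivative
      (-5/2) * (1 + (P t)\<^sup>2) powr (-5/2 - 1) * (2 * P t * r)) (at t)"
    using DERIV_fun_powr[OF P pos, of "-5/2"] by simp
  from DERIV_add[OF DERIV_chain2[OF DERIV_real_sqrt[OF pos] P] DERIV_mult[OF Q this]]
  have "((\<lambda>t. sqrt (1 + (P t)\<^sup>2) + \<gamma> * (Q t)\<^sup>2 * (1 + (P t)\<^sup>2) powr (-5/2)) has_real_derivative
      inverse (sqrt (1 + (P t)\<^sup>2)) / 2 * (2 * P t * r) +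
      (2 * \<gamma> * Q t * s * (1 + (P t)\<^sup>2) powr (-5/2) +
       (-5/2) * (1 + (P t)\<^sup>2) powr (-5/2 - 1) * (2 * P t * r) * (\<gamma> * (Q t)\<^sup>2))) (at t)" .
  moreover have "(1 + (P t)\<^sup>2) powr (-5/2) = inverse ((1 + (P t)\<^sup>2) powr (5/2))"
    "(1 + (P t)\<^sup>2) powr (-5/2 - 1) = inverse ((1 + (P t)\<^sup>2) powr (7/2))" for t
    by (simp_all flip: powr_minus)
  moreover have "inverse S / 2 * (2 * x * r) +
      (2 * \<gamma> * y * s * inverse A + (-5/2) * inverse B * (2 * x * r) * (\<gamma> * y\<^sup>2)) =
      (x / S - 5 * \<gamma> * y\<^sup>2 * x / B) * r + 2 * \<gamma> * y / A * s" for A B S x y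
    by (simp add: inverse_eq_divide algebra_simps)
  ultimately have "((\<lambda>t. sqrt (1 + (P t)\<^sup>2) + \<gamma> * (Q t)\<^sup>2 * inverse ((1 + (P t)\<^sup>2) powr (5/2)))
      has_real_derivative lagrangian_p \<gamma> (P t) (Q t) * r + lagrangian_q \<gamma> (P t) (Q t) * s) (at t)"
    unfolding lagrangian_p_def lagrangian_q_def by (simp only:)
  then show ?thesis
    unfolding lagrangian_def divide_inverse P_def Q_def .
qed

text \<open>Both denominators dominate the numerator \<open>p\<close>, because
  \<open>\<bar>p\<bar> \<le> sqrt (1 + p\<^sup>2)\<close> and \<open>1 + p\<^sup>2\<close> is at
  least 1. No bound on the slope enters.\<close>

lemma lagrangian_p_bound:
  assumes "\<gamma> > 0"
  shows "\<bar>lagrangian_p \<gamma> p q\<bar> \<le> 1 + 5 * \<gamma> * q\<^sup>2"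
proof -
  have p: "\<bar>p\<bar> \<le> sqrt (1 + p\<^sup>2)"
    by (rule real_le_rsqrt) simp
  have ge1: "1 \<le> 1 + p\<^sup>2" by simp
  have "\<bar>p\<bar> \<le> (1 + p\<^sup>2) powr (1/2)"
    using p by (simp add: powr_half_sqrt)
  also have "\<dots> \<le> (1 + p\<^sup>2) powr (7/2)"
    by (rule powr_mono[OF _ ge1]) simp
  finally have "\<bar>p\<bar> / (1 + p\<^sup>2) powr (7/2) \<le> 1"
    by (simp add: divide_le_eq)
  then have "5 * \<gamma> * q\<^sup>2 * (\<bar>p\<bar> / (1 + p\<^sup>2) powr (7/2)) \<le> 5 * \<gamma> * q\<^sup>2 * 1"
    using assms by (intro mult_left_mono) auto
  moreover have "\<bar>5 * \<gamma> * q\<^sup>2 * p / (1 + p\<^sup>2) powr (7/2)\<bar> = 5 * \<gamma> * q\<^sup>2 * (\<bar>p\<bar> / (1 + p\<^sup>2) powr (7/2))"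
    using assms by (simp add: abs_mult)
  moreover have "\<bar>p / sqrt (1 + p\<^sup>2)\<bar> \<le> 1"
    using p by (simp add: divide_le_eq add_pos_nonneg)
  ultimately show ?thesis
    unfolding lagrangian_p_def by linarith
qed

text \<open>The denominator is at least 1, and \<open>2 * \<bar>q\<bar> \<le> 1 + q\<^sup>2\<close>
  turns the linear growth into a quadratic one, matching the bound for
  \<open>lagrangian_p\<close>.\<close>

lemma lagrangian_q_bound:
  assumes "\<gamma> > 0"
  shows "\<bar>lagrangian_q \<gamma> p q\<bar> \<le> \<gamma> * (1 + q\<^sup>2)"
proof -
  have "\<bar>lagrangian_q \<gamma> p q\<bar> = \<gamma> * (2 * \<bar>q\<bar>) / (1 + p\<^sup>2) powr (5/2)"
    using assms by (simp add: lagrangian_q_def abs_mult)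
  also have "\<dots> \<le> \<gamma> * (2 * \<bar>q\<bar>) / 1"
    using assms ge_one_powr_ge_zero[of "1 + p\<^sup>2" "5/2"] by (intro divide_left_mono) auto
  also have "\<dots> \<le> \<gamma> * (1 + q\<^sup>2)"
    using assms sum_squares_bound[of 1 "\<bar>q\<bar>"] by simp
  finally show ?thesis .
qed

text \<open>By the mean value theorem the quotient is the derivative at some t between 0 and h. As
  \<open>h \<le> 1\<close>, the square of \<open>q + t * s\<close> is at most
  \<open>2 * q\<^sup>2 + 2 * M\<^sup>2\<close>, a bound independent of h. The factor 6 is the sum of
  the 5 and the 1 from the bounds on the two partial derivatives.\<close>

lemma lagrangian_quotient_bound:
  assumes "\<gamma> > 0" "\<bar>r\<bar> \<le> M" "\<bar>s\<bar> \<le> M" "0 < h" "h \<le> 1"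
  shows "\<bar>(lagrangian \<gamma> (p + h * r) (q + h * s) - lagrangian \<gamma> p q) / h\<bar> \<le>
    (1 + 6 * \<gamma> * (1 + 2 * q\<^sup>2 + 2 * M\<^sup>2)) * M"
proof -
  define f where "f t = lagrangian \<gamma> (p + t * r) (q + t * s)" for t
  define f' where "f' t = lagrangian_p \<gamma> (p + t * r) (q + t * s) * r
    + lagrangian_q \<gamma> (p + t * r) (q + t * s) * s" for t
  have "(f has_real_derivative f' t) (at t)" for t
    unfolding f_def f'_def by (rule lagrangian_has_derivative)
  then obtain t where t: "0 < t" "t < h" and eq: "f h - f 0 = (h - 0) * f' t"
    using MVT2[OF assms(4), of f f'] by blast
  let ?q = "q + t * s"
  have "\<bar>t * s\<bar> \<le> 1 * M"
    unfolding abs_mult using t assms by (intro mult_mono) auto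
  then have "(t * s)\<^sup>2 \<le> M\<^sup>2"
    by (simp add: abs_le_square_iff[symmetric])
  then have q: "?q\<^sup>2 \<le> 2 * q\<^sup>2 + 2 * M\<^sup>2"
    using sum_squares_bound[of q "t * s"] by (simp add: power2_sum)
  have M: "M \<ge> 0" using assms(2) by linarith
  have "\<bar>lagrangian_p \<gamma> (p + t * r) ?q * r\<bar> \<le> (1 + 5 * \<gamma> * ?q\<^sup>2) * M"
    unfolding abs_mult using assms M by (intro mult_mono lagrangian_p_bound) auto
  moreover have "\<bar>lagrangian_q \<gamma> (p + t * r) ?q * s\<bar> \<le> (\<gamma> * (1 + ?q\<^sup>2)) * M"
    unfolding abs_mult using assms M by (intro mult_mono lagrangian_q_bound) auto
  moreover have "(1 + 5 * \<gamma> * ?q\<^sup>2) * M + (\<gamma> * (1 + ?q\<^sup>2)) * M \<le> (1 + 6 * \<gamma> * (1 + ?q\<^sup>2)) * M"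
    using assms(1) M by (simp add: algebra_simps)
  moreover have "(1 + 6 * \<gamma> * (1 + ?q\<^sup>2)) * M \<le> (1 + 6 * \<gamma> * (1 + (2 * q\<^sup>2 + 2 * M\<^sup>2))) * M"
    using assms(1) M q by (intro mult_right_mono add_left_mono mult_left_mono) auto
  ultimately have "\<bar>f' t\<bar> \<le> (1 + 6 * \<gamma> * (1 + (2 * q\<^sup>2 + 2 * M\<^sup>2))) * M"
    unfolding f'_def by linarith
  moreover have "(f h - f 0) / h = f' t"
    using eq assms(4) by simp
  ultimately show ?thesis
    by (simp add: f_def add.assoc)
qed

text \<open>The weight is continuous on a compact interval, hence bounded, and both \<open>q\<close>
  and its square are integrable there.\<close>

lemma weighted_square_integrable:
  assumes "continuous_on {l..u} p" "q \<in> L2 l u" "continuous_on {l..u} c"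
  shows "set_integrable lebesgue {l..u} (\<lambda>x. c x * (q x)\<^sup>2 / (1 + (p x)\<^sup>2) powr e)"
    and "set_integrable lebesgue {l..u} (\<lambda>x. c x * q x / (1 + (p x)\<^sup>2) powr e)"
proof -
  have cont: "continuous_on {l..u} (\<lambda>x. c x / (1 + (p x)\<^sup>2) powr e)"
    by (intro continuous_intros assms) (auto simp: one_plus_sq_neq0)
  have "set_integrable lebesgue {l..u} (\<lambda>x. (q x)\<^sup>2)"
    using assms(2) by (simp add: L2_def)
  from continuous_mult_integrable[OF cont this]
  show "set_integrable lebesgue {l..u} (\<lambda>x. c x * (q x)\<^sup>2 / (1 + (p x)\<^sup>2) powr e)"
    by simp
  show "set_integrable lebesgue {l..u} (\<lambda>x. c x * q x / (1 + (p x)\<^sup>2) powr e)"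
    using continuous_mult_integrable[OF cont L2_set_integrable[OF assms(2)]] by simp
qed

lemma lagrangian_integrable:
  assumes "continuous_on {l..u} p" "q \<in> L2 l u"
  shows "set_integrable lebesgue {l..u} (\<lambda>x. lagrangian \<gamma> (p x) (q x))"
  unfolding lagrangian_def
  by (intro set_integral_add(1) weighted_square_integrable assms continuous_set_integrable
      continuous_intros)

lemma variation_integrable:
  assumes "continuous_on {l..u} p" "q \<in> L2 l u" "continuous_on {l..u} r"
  shows "set_integrable lebesgue {l..u} (\<lambda>x. lagrangian_p \<gamma> (p x) (q x) * r x)"
    and "set_integrable lebesgue {l..u} (\<lambda>x. lagrangian_q \<gamma> (p x) (q x) * r x)"
proof -
  have "continuous_on {l..u} (\<lambda>x. p x / sqrt (1 + (p x)\<^sup>2) * r x)"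
    by (intro continuous_intros assms) (auto simp: one_plus_sq_neq0)
  moreover have "continuous_on {l..u} (\<lambda>x. 5 * \<gamma> * p x * r x)"
    by (intro continuous_intros assms)
  ultimately have "set_integrable lebesgue {l..u} (\<lambda>x. p x / sqrt (1 + (p x)\<^sup>2) * r x
      - (5 * \<gamma> * p x * r x) * (q x)\<^sup>2 / (1 + (p x)\<^sup>2) powr (7/2))"
    by (intro set_integral_diff(1) weighted_square_integrable assms continuous_set_integrable)
  moreover have "lagrangian_p \<gamma> (p x) (q x) * r x = p x / sqrt (1 + (p x)\<^sup>2) * r x
      - (5 * \<gamma> * p x * r x) * (q x)\<^sup>2 / (1 + (p x)\<^sup>2) powr (7/2)" for x
    by (simp add: lagrangian_p_def algebra_simps)
  ultimately show "set_integrable lebesgue {l..u} (\<lambda>x. lagrangian_p \<gamma> (p x) (q x) * r x)"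
    by (simp only:)
  have "set_integrable lebesgue {l..u} (\<lambda>x. 2 * \<gamma> * r x * q x / (1 + (p x)\<^sup>2) powr (5/2))"
    by (intro weighted_square_integrable assms continuous_intros)
  moreover have "lagrangian_q \<gamma> (p x) (q x) * r x = 2 * \<gamma> * r x * q x / (1 + (p x)\<^sup>2) powr (5/2)" for x
    by (simp add: lagrangian_q_def)
  ultimately show "set_integrable lebesgue {l..u} (\<lambda>x. lagrangian_q \<gamma> (p x) (q x) * r x)"
    by (simp only:)
qed

section \<open>Differentiation under the integral\<close>

text \<open>The directional derivative of the integral of the Lagrangian at \<open>(p, q)\<close>.
  The directions \<open>r\<close> and \<open>s\<close> are unrelated here; a perturbation
  \<open>\<phi>\<close> later supplies its first and second derivative for them.\<close>

definition first_variation ::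
  "real \<Rightarrow> real \<Rightarrow> real \<Rightarrow> (real \<Rightarrow> real) \<Rightarrow> (real \<Rightarrow> real) \<Rightarrow> (real \<Rightarrow> real) \<Rightarrow> (real \<Rightarrow> real) \<Rightarrow> real"
  where "first_variation \<gamma> l u p q r s = (LINT x:{l..u}|lebesgue.
    lagrangian_p \<gamma> (p x) (q x) * r x + lagrangian_q \<gamma> (p x) (q x) * s x)"

text \<open>The steps \<open>inverse (real (Suc n))\<close> form a sequence, as dominated
  convergence requires, and lie in the range from 0 to 1 where the quotient bound holds.\<close>

lemma lagrangian_integral_quotient_tendsto:
  assumes \<gamma>: "\<gamma> > 0" and p: "continuous_on {l..u} p" and q: "q \<in> L2 l u"
    and r: "continuous_on {l..u} r" and s: "continuous_on {l..u} s"
  shows "(\<lambda>n. ((LINT x:{l..u}|lebesgue. lagrangian \<gamma> (p x + inverse (real (Suc n)) * r x)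
                                               (q x + inverse (real (Suc n)) * s x))
              - (LINT x:{l..u}|lebesgue. lagrangian \<gamma> (p x) (q x))) / inverse (real (Suc n)))
    \<longlonglongrightarrow> first_variation \<gamma> l u p q r s"
proof -
  define h where "h n = inverse (real (Suc n))" for n
  have h: "0 < h n" "h n \<le> 1" for n
    by (auto simp: h_def divide_simps)
  have h0: "filterlim h (at 0) sequentially"
    using LIMSEQ_inverse_real_of_nat h(1)
    by (intro filterlim_atI) (auto simp: h_def[abs_def] less_imp_neq[THEN not_sym])
  define L where "L n x = lagrangian \<gamma> (p x + h n * r x) (q x + h n * s x)" for n x
  define Q where "Q n x = (L n x - lagrangian \<gamma> (p x) (q x)) / h n" for n x
  have L: "set_integrable lebesgue {l..u} (L n)" for n
    unfolding L_def
    by (intro lagrangian_integrable L2_add q continuous_in_L2 continuous_intros p r s)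
  have Q: "set_integrable lebesgue {l..u} (Q n)" for n
    unfolding Q_def by (intro set_integrable_divide set_integral_diff(1) L lagrangian_integrable p q)
  have int_Q: "(LINT x:{l..u}|lebesgue. Q n x) =
      ((LINT x:{l..u}|lebesgue. L n x) - (LINT x:{l..u}|lebesgue. lagrangian \<gamma> (p x) (q x))) / h n" for n
    unfolding Q_def by (simp add: set_integral_diff(2)[OF L lagrangian_integrable[OF p q]])
  obtain M where M: "\<And>x. x \<in> {l..u} \<Longrightarrow> \<bar>r x\<bar> \<le> M" "\<And>x. x \<in> {l..u} \<Longrightarrow> \<bar>s x\<bar> \<le> M"
  proof -
    have "compact (r ` {l..u} \<union> s ` {l..u})"
      by (intro compact_Un compact_continuous_image r s) auto
    then obtain M where "\<And>y. y \<in> r ` {l..u} \<union> s ` {l..u} \<Longrightarrow> norm y \<le> M"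
      using compact_imp_bounded[of "r ` {l..u} \<union> s ` {l..u}"] unfolding bounded_iff by blast
    then show ?thesis
      by (intro that[of M]) (simp_all only: real_norm_def image_eqI UnI1 UnI2)
  qed
  define w where "w x = (1 + 6 * \<gamma> * (1 + 2 * (q x)\<^sup>2 + 2 * M\<^sup>2)) * M" for x
  have w: "set_integrable lebesgue {l..u} w"
  proof -
    have "set_integrable lebesgue {l..u} (\<lambda>x. (q x)\<^sup>2)"
      using q by (simp add: L2_def)
    then have "set_integrable lebesgue {l..u} (\<lambda>x. (12 * \<gamma> * M) * (q x)\<^sup>2 + (1 + 6 * \<gamma> * (1 + 2 * M\<^sup>2)) * M)"
      by (intro set_integral_add(1)[OF set_integrable_mult_right]
          continuous_set_integrable[OF continuous_on_const])
    moreover have "w = (\<lambda>x. (12 * \<gamma> * M) * (q x)\<^sup>2 + (1 + 6 * \<gamma> * (1 + 2 * M\<^sup>2)) * M)"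
      by (simp add: w_def fun_eq_iff algebra_simps)
    ultimately show ?thesis by simp
  qed
  define V where "V x = lagrangian_p \<gamma> (p x) (q x) * r x + lagrangian_q \<gamma> (p x) (q x) * s x" for x
  have V: "set_integrable lebesgue {l..u} V"
    unfolding V_def by (intro set_integral_add(1) variation_integrable p q r s)
  have lim: "(\<lambda>n. Q n x) \<longlonglongrightarrow> V x" for x
  proof -
    have "((\<lambda>t. (lagrangian \<gamma> (p x + (0 + t) * r x) (q x + (0 + t) * s x)
        - lagrangian \<gamma> (p x + 0 * r x) (q x + 0 * s x)) / t) \<longlongrightarrow>
        lagrangian_p \<gamma> (p x + 0 * r x) (q x + 0 * s x) * r x +
        lagrangian_q \<gamma> (p x + 0 * r x) (q x + 0 * s x) * s x) (at 0)"
      using lagrangian_has_derivative unfolding DERIV_def .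
    from filterlim_compose[OF this h0] show ?thesis
      by (simp add: Q_def L_def V_def)
  qed
  have "(\<lambda>n. LINT x|lebesgue. indicator {l..u} x *\<^sub>R Q n x) \<longlonglongrightarrow> (LINT x|lebesgue. indicator {l..u} x *\<^sub>R V x)"
  proof (rule integral_dominated_convergence[where w = "\<lambda>x. indicator {l..u} x *\<^sub>R w x"])
    show "(\<lambda>x. indicator {l..u} x *\<^sub>R V x) \<in> borel_measurable lebesgue"
      "(\<lambda>x. indicator {l..u} x *\<^sub>R Q n x) \<in> borel_measurable lebesgue" for n
      using V Q unfolding set_integrable_def by (auto dest: borel_measurable_integrable)
    show "integrable lebesgue (\<lambda>x. indicator {l..u} x *\<^sub>R w x)"
      using w unfolding set_integrable_def .
    show "AE x in lebesgue. (\<lambda>n. indicator {l..u} x *\<^sub>R Q n x) \<longlonglongrightarrow> indicator {l..u} x *\<^sub>R V x"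
      by (intro AE_I2 tendsto_intros lim)
    have "\<bar>Q n x\<bar> \<le> w x" if "x \<in> {l..u}" for n x
      unfolding Q_def L_def w_def using that by (intro lagrangian_quotient_bound \<gamma> M h)
    then show "AE x in lebesgue. norm (indicator {l..u} x *\<^sub>R Q n x) \<le> indicator {l..u} x *\<^sub>R w x" for n
      by (intro AE_I2) (auto simp: indicator_def)
  qed
  then show ?thesis
    using int_Q unfolding set_lebesgue_integral_def[symmetric] first_variation_def V_def L_def h_def
    by simp
qed

subsection \<open>Perturbation by test functions\<close>

lemma D1_add_test:
  assumes "l < u" "C1_on l u f" "test_function l u \<phi>"
  shows "C1_on l u (\<lambda>x. f x + \<phi> x)"
    and "x \<in> {l..u} \<Longrightarrow> D1 l u (\<lambda>x. f x + \<phi> x) x = D1 l u f x + deriv \<phi> x"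
proof -
  note smooth = test_function_smooth[OF assms(3)]
  have der: "((\<lambda>x. f x + \<phi> x) has_real_derivative D1 l u f x + deriv \<phi> x) (at x within {l..u})"
    if "x \<in> {l..u}" for x
    by (intro DERIV_add D1_has_derivative(2)[OF assms(1,2) that]
        DERIV_subset[OF smooth_has_derivative[OF smooth]] subset_UNIV)
  have "continuous_on {l..u} (\<lambda>x. D1 l u f x + deriv \<phi> x)"
    by (intro continuous_on_add D1_has_derivative(1) assms smooth_continuous_on smooth_deriv smooth)
  with der show "C1_on l u (\<lambda>x. f x + \<phi> x)"
    unfolding C1_on_def by blast
  show "D1 l u (\<lambda>x. f x + \<phi> x) x = D1 l u f x + deriv \<phi> x" if "x \<in> {l..u}"
    using vector_derivative_within_cbox[of l u x] assms(1) that der[OF that]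
    by (simp add: D1_def has_real_derivative_iff_has_vector_derivative)
qed

lemma W22_add_test:
  assumes "l < u" "f \<in> W22 l u" "test_function l u \<phi>"
  shows "(\<lambda>x. f x + \<phi> x) \<in> W22 l u"
proof -
  have L2_test: "(deriv ^^ k) \<phi> \<in> L2 l u" for k
    by (intro continuous_in_L2 smooth_continuous_on test_function_smooth[OF
          test_function_funpow_deriv[OF assms(3)]])
  have weak: "\<exists>g\<in>L2 l u. has_weak_deriv k l u (\<lambda>x. f x + \<phi> x) g"
    if ex: "\<exists>g\<in>L2 l u. has_weak_deriv k l u f g" for k
  proof -
    obtain g where "g \<in> L2 l u" "has_weak_deriv k l u f g"
      using ex by blast
    then show ?thesis
      using assms L2_add[OF _ L2_test]
      by (intro bexI[of _ "\<lambda>x. g x + (deriv ^^ k) \<phi> x"] has_weak_deriv_add_test)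
        (simp_all add: W22_def)
  qed
  have "(\<lambda>x. f x + \<phi> x) \<in> L2 l u"
    using L2_add[OF _ L2_test[of 0]] assms(2) by (simp add: W22_def)
  then show ?thesis
    using assms(2) D1_add_test(1)[OF assms(1) _ assms(3)] weak by (simp add: W22_def)
qed

lemma D2_add_test:
  assumes "l < u" "f \<in> W22 l u" "test_function l u \<phi>"
  shows "AE x\<in>{l..u} in lebesgue. D2 l u (\<lambda>x. f x + \<phi> x) x = D2 l u f x + deriv (deriv \<phi>) x"
proof (rule weak_deriv_unique[OF _ _ D2_weak_deriv(2)])
  show "D2 l u (\<lambda>x. f x + \<phi> x) \<in> L2 l u" "(\<lambda>x. f x + \<phi> x) \<in> W22 l u"
    using W22_add_test[OF assms] by (auto intro: D2_weak_deriv)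
  show "(\<lambda>x. D2 l u f x + deriv (deriv \<phi>) x) \<in> L2 l u"
    by (intro L2_add D2_weak_deriv assms continuous_in_L2 smooth_continuous_on smooth_deriv
        test_function_smooth[OF assms(3)])
  have "f \<in> L2 l u"
    using assms(2) by (simp add: W22_def)
  from has_weak_deriv_add_test[OF assms(1) this D2_weak_deriv[OF assms(2)] assms(3)]
  show "has_weak_deriv 2 l u (\<lambda>x. f x + \<phi> x) (\<lambda>x. D2 l u f x + deriv (deriv \<phi>) x)"
    by (simp add: numeral_2_eq_2)
qed

text \<open>The first derivative of the sum is known at every point of the closed interval, the
  chosen second one only almost everywhere. This suffices for the integral once both integrands are
  known to be measurable.\<close>

lemma J_add_test:
  assumes "a > 0" "f \<in> W22 (-a) a" "test_function (-a) a \<phi>"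
  shows "J a \<gamma> (\<lambda>x. f x + \<phi> x) = (LINT x:{-a..a}|lebesgue.
    lagrangian \<gamma> (D1 (-a) a f x + deriv \<phi> x) (D2 (-a) a f x + deriv (deriv \<phi>) x))"
proof -
  let ?g = "\<lambda>x. f x + \<phi> x"
  have lt: "-a < a" using assms(1) by simp
  note smooth = test_function_smooth[OF assms(3)]
  note W = W22_add_test[OF lt assms(2,3)]
  have C1: "C1_on (-a) a f" "C1_on (-a) a ?g"
    using assms(2) W by (simp_all add: W22_def)
  have "J a \<gamma> ?g = (LINT x:{-a..a}|lebesgue. lagrangian \<gamma> (D1 (-a) a ?g x) (D2 (-a) a ?g x))"
    unfolding J_def J_integrand lagrangian_def ..
  also have "\<dots> = (LINT x:{-a..a}|lebesgue.
    lagrangian \<gamma> (D1 (-a) a f x + deriv \<phi> x) (D2 (-a) a f x + deriv (deriv \<phi>) x))"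
    unfolding set_lebesgue_integral_def
  proof (rule integral_cong_AE)
    have "set_integrable lebesgue {-a..a} (\<lambda>x. lagrangian \<gamma> (D1 (-a) a ?g x) (D2 (-a) a ?g x))"
      by (intro lagrangian_integrable D1_has_derivative(1)[OF lt C1(2)] D2_weak_deriv(1)[OF W])
    then show "(\<lambda>x. indicat_real {-a..a} x *\<^sub>R lagrangian \<gamma> (D1 (-a) a ?g x) (D2 (-a) a ?g x))
        \<in> borel_measurable lebesgue"
      unfolding set_integrable_def by (rule borel_measurable_integrable)
    have "set_integrable lebesgue {-a..a}
        (\<lambda>x. lagrangian \<gamma> (D1 (-a) a f x + deriv \<phi> x) (D2 (-a) a f x + deriv (deriv \<phi>) x))"
      by (intro lagrangian_integrable continuous_on_add D1_has_derivative(1)[OF lt C1(1)] L2_add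
          D2_weak_deriv(1)[OF assms(2)] continuous_in_L2 smooth_continuous_on smooth_deriv smooth)
    then show "(\<lambda>x. indicat_real {-a..a} x *\<^sub>R
        lagrangian \<gamma> (D1 (-a) a f x + deriv \<phi> x) (D2 (-a) a f x + deriv (deriv \<phi>) x))
        \<in> borel_measurable lebesgue"
      unfolding set_integrable_def by (rule borel_measurable_integrable)
    show "AE x in lebesgue. indicat_real {-a..a} x *\<^sub>R lagrangian \<gamma> (D1 (-a) a ?g x) (D2 (-a) a ?g x) =
        indicat_real {-a..a} x *\<^sub>R
        lagrangian \<gamma> (D1 (-a) a f x + deriv \<phi> x) (D2 (-a) a f x + deriv (deriv \<phi>) x)"
      using D2_add_test[OF lt assms(2,3)]
    proof eventually_elim
      case (elim x)
      then show ?case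
        using D1_add_test(2)[OF lt C1(1) assms(3), of x] by (cases "x \<in> {-a..a}") simp_all
    qed
  qed
  finally show ?thesis .
qed

section \<open>Minimality and the Lagrange multiplier\<close>

lemma admissible_add_test:
  assumes "a > 0" "f \<in> admissible a A\<^sub>0" "test_function (-a) a \<phi>"
    "(LINT x:{-a..a}|lebesgue. \<phi> x) = 0"
  shows "(\<lambda>x. f x + \<phi> x) \<in> admissible a A\<^sub>0"
proof -
  have lt: "-a < a" using assms(1) by simp
  have f: "f \<in> W22 (-a) a"
    using assms(2) by (simp add: admissible_def)
  then have C1: "C1_on (-a) a f" and L2: "f \<in> L2 (-a) a"
    by (simp_all add: W22_def)
  have ends: "\<phi> (-a) = 0" "\<phi> a = 0" "deriv \<phi> (-a) = 0" "deriv \<phi> a = 0"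
    by (rule test_function_outside[OF assms(3)] test_function_outside[OF test_function_deriv[OF assms(3)]],
        simp)+
  have "set_integrable lebesgue {-a..a} \<phi>"
    by (intro continuous_set_integrable smooth_continuous_on test_function_smooth[OF assms(3)])
  then have "(LINT x:{-a..a}|lebesgue. f x + \<phi> x) = A\<^sub>0"
    using assms(2,4) L2_set_integrable[OF L2] by (simp add: set_integral_add(2) admissible_def)
  moreover have "D1 (-a) a (\<lambda>x. f x + \<phi> x) (-a) = 0" "D1 (-a) a (\<lambda>x. f x + \<phi> x) a = 0"
    using assms(2) lt D1_add_test(2)[OF lt C1 assms(3)] ends by (simp_all add: admissible_def)
  ultimately show ?thesis
    using assms(2) ends W22_add_test[OF lt f assms(3)] by (simp add: admissible_def)
qed

lemma first_variation_nonneg: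
  assumes "a > 0" "\<gamma> > 0" "is_minimizer a \<gamma> A\<^sub>0 f" "test_function (-a) a \<phi>"
    "(LINT x:{-a..a}|lebesgue. \<phi> x) = 0"
  shows "0 \<le> first_variation \<gamma> (-a) a (D1 (-a) a f) (D2 (-a) a f) (deriv \<phi>) (deriv (deriv \<phi>))"
proof -
  have lt: "-a < a" using assms(1) by simp
  have adm: "f \<in> admissible a A\<^sub>0" and min: "\<And>g. g \<in> admissible a A\<^sub>0 \<Longrightarrow> J a \<gamma> f \<le> J a \<gamma> g"
    using assms(3) by (simp_all add: is_minimizer_def)
  have f: "f \<in> W22 (-a) a"
    using adm by (simp add: admissible_def)
  then have C1: "C1_on (-a) a f"
    by (simp add: W22_def)
  note smooth = test_function_smooth[OF assms(4)]
  define h where "h n = inverse (real (Suc n))" for n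
  let ?p = "D1 (-a) a f" and ?q = "D2 (-a) a f"
  have J_f: "J a \<gamma> f = (LINT x:{-a..a}|lebesgue. lagrangian \<gamma> (?p x) (?q x))"
    unfolding J_def J_integrand lagrangian_def ..
  have J_h: "J a \<gamma> (\<lambda>x. f x + c * \<phi> x) = (LINT x:{-a..a}|lebesgue.
      lagrangian \<gamma> (?p x + c * deriv \<phi> x) (?q x + c * deriv (deriv \<phi>) x))" for c
  \<comment> \<open>The factor \<open>c\<close> passes through both classical derivatives by
    smoothness, which turns the perturbation \<open>c * \<phi>\<close> into the form treated by the
    quotient limit.\<close>
  proof -
    have "deriv (\<lambda>x. c * \<psi> x) = (\<lambda>x. c * deriv \<psi> x)" if "smooth \<psi>" for \<psi>
      using DERIV_cmult[OF smooth_has_derivative[OF that], of c] by (intro ext DERIV_imp_deriv)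
    then show ?thesis
      using J_add_test[OF assms(1) f test_function_scale[OF assms(4)], of \<gamma> c] smooth smooth_deriv
      by simp
  qed
  have le: "J a \<gamma> f \<le> J a \<gamma> (\<lambda>x. f x + h n * \<phi> x)" for n
    using assms(5) by (intro min admissible_add_test assms(1) adm test_function_scale assms(4)) simp
  have "(\<lambda>n. (J a \<gamma> (\<lambda>x. f x + h n * \<phi> x) - J a \<gamma> f) / h n) \<longlonglongrightarrow>
      first_variation \<gamma> (-a) a ?p ?q (deriv \<phi>) (deriv (deriv \<phi>))"
    unfolding J_h J_f h_def
    by (intro lagrangian_integral_quotient_tendsto assms(2) D1_has_derivative(1)[OF lt C1]
        D2_weak_deriv(1)[OF f] smooth_continuous_on smooth_deriv smooth)
  then show ?thesis
    by (rule LIMSEQ_le_const) (use le in \<open>auto simp: h_def intro!: divide_nonneg_pos exI[of _ 0]\<close>)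
qed

theorem mainTheorem3:
  fixes a \<gamma> A\<^sub>0 :: real and f :: "real \<Rightarrow> real"
  assumes "a > 0" and "\<gamma> > 0" and "A\<^sub>0 > 0"
    and "is_minimizer a \<gamma> A\<^sub>0 f"
  shows "\<exists>lam::real. \<forall>\<phi>. test_function (-a) a \<phi> \<longrightarrow>
    dist_deriv (dist_deriv (regular_dist (-a) a
      (\<lambda>x. 2 * \<gamma> * D2 (-a) a f x / (1 + (D1 (-a) a f x)\<^sup>2) powr (5/2)))) \<phi>
    - dist_deriv (regular_dist (-a) a
      (\<lambda>x. D1 (-a) a f x / sqrt (1 + (D1 (-a) a f x)\<^sup>2)
         - 5 * \<gamma> * (D2 (-a) a f x)\<^sup>2 * D1 (-a) a f x / (1 + (D1 (-a) a f x)\<^sup>2) powr (7/2))) \<phi>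
    + regular_dist (-a) a (\<lambda>x. lam) \<phi> = 0"
proof -
  have lt: "-a < a" using assms(1) by simp
  have f: "f \<in> W22 (-a) a"
    using assms(4) by (simp add: is_minimizer_def admissible_def)
  then have C1: "C1_on (-a) a f"
    by (simp add: W22_def)
  let ?p = "D1 (-a) a f" and ?q = "D2 (-a) a f"
  note p = D1_has_derivative(1)[OF lt C1] and q = D2_weak_deriv(1)[OF f]
  \<comment> \<open>\<open>\<delta>\<close> and \<open>m\<close> are linear functionals on the test
    functions; the aim is that \<open>\<delta>\<close> is a multiple of \<open>m\<close>, for which
    it has to vanish on the kernel of \<open>m\<close>.\<close>
  define \<delta> where "\<delta> \<phi> = first_variation \<gamma> (-a) a ?p ?q (deriv \<phi>) (deriv (deriv \<phi>))" for \<phi>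
  define m where "m \<phi> = (LINT x:{-a..a}|lebesgue. \<phi> x)" for \<phi> :: "real \<Rightarrow> real"
  have int: "set_integrable lebesgue {-a..a} (\<lambda>x. lagrangian_p \<gamma> (?p x) (?q x) * \<phi> x)"
    "set_integrable lebesgue {-a..a} (\<lambda>x. lagrangian_q \<gamma> (?p x) (?q x) * \<phi> x)"
    "set_integrable lebesgue {-a..a} \<phi>"
    if "test_function (-a) a \<phi>" for \<phi>
    by (intro variation_integrable p q continuous_set_integrable smooth_continuous_on
        test_function_smooth[OF that])+
  have \<delta>_eq: "\<delta> \<phi> = (LINT x:{-a..a}|lebesgue. lagrangian_p \<gamma> (?p x) (?q x) * deriv \<phi> x)
      + (LINT x:{-a..a}|lebesgue. lagrangian_q \<gamma> (?p x) (?q x) * deriv (deriv \<phi>) x)"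
    if "test_function (-a) a \<phi>" for \<phi>
    unfolding \<delta>_def first_variation_def
    by (intro set_integral_add(2) int test_function_deriv that)
  \<comment> \<open>This single form of linearity serves two uses: negating a test function, and
    correcting its mean by a multiple of another one.\<close>
  have combination: "test_function (-a) a (\<lambda>x. c * \<phi> x + \<psi> x)"
    "\<delta> (\<lambda>x. c * \<phi> x + \<psi> x) = c * \<delta> \<phi> + \<delta> \<psi>" "m (\<lambda>x. c * \<phi> x + \<psi> x) = c * m \<phi> + m \<psi>"
    if \<phi>: "test_function (-a) a \<phi>" and \<psi>: "test_function (-a) a \<psi>" for \<phi> \<psi> c
  proof -
    show test: "test_function (-a) a (\<lambda>x. c * \<phi> x + \<psi> x)"
      by (intro test_function_add test_function_scale \<phi> \<psi>)
    have d: "deriv (\<lambda>x. c * \<phi> x + \<psi> x) = (\<lambda>x. c * deriv \<phi> x + deriv \<psi> x)"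
      if "test_function (-a) a \<phi>" "test_function (-a) a \<psi>" for \<phi> \<psi>
      by (intro ext DERIV_imp_deriv DERIV_add DERIV_cmult smooth_has_derivative
          test_function_smooth[OF that(1)] test_function_smooth[OF that(2)])
    note \<phi>' = \<phi>[THEN test_function_deriv] and \<psi>' = \<psi>[THEN test_function_deriv]
    note ints = int(1)[OF \<phi>'] int(1)[OF \<psi>']
      int(2)[OF \<phi>'[THEN test_function_deriv]] int(2)[OF \<psi>'[THEN test_function_deriv]]
    \<comment> \<open>The weight \<open>w\<close> stands for either partial derivative of the
      Lagrangian along f, or for the constant 1 in the case of the mean.\<close>
    have lin: "(LINT x:{-a..a}|lebesgue. w x * (c * r x + s x)) =
        c * (LINT x:{-a..a}|lebesgue. w x * r x) + (LINT x:{-a..a}|lebesgue. w x * s x)"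
      if "set_integrable lebesgue {-a..a} (\<lambda>x. w x * r x)"
        "set_integrable lebesgue {-a..a} (\<lambda>x. w x * s x)" for w r s :: "real \<Rightarrow> real"
    proof -
      have "(LINT x:{-a..a}|lebesgue. c * (w x * r x) + w x * s x) =
        c * (LINT x:{-a..a}|lebesgue. w x * r x) + (LINT x:{-a..a}|lebesgue. w x * s x)"
        by (subst set_integral_add(2)[OF set_integrable_mult_right[OF that(1)] that(2)])
          (simp only: set_integral_mult_right)
      moreover have "w x * (c * r x + s x) = c * (w x * r x) + w x * s x" for x
        by (simp add: algebra_simps)
      ultimately show ?thesis by simp
    qed
    show "\<delta> (\<lambda>x. c * \<phi> x + \<psi> x) = c * \<delta> \<phi> + \<delta> \<psi>"
      unfolding \<delta>_eq[OF \<phi>] \<delta>_eq[OF \<psi>] \<delta>_eq[OF test] d[OF \<phi> \<psi>] d[OF \<phi>' \<psi>']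
        lin[OF ints(1,2)] lin[OF ints(3,4)]
      by (simp add: distrib_left)
    show "m (\<lambda>x. c * \<phi> x + \<psi> x) = c * m \<phi> + m \<psi>"
      unfolding m_def using lin[of "\<lambda>_. 1" \<phi> \<psi>] int(3)[OF \<phi>] int(3)[OF \<psi>] by simp
  qed
  have \<delta>_zero: "\<delta> \<phi> = 0" if \<phi>: "test_function (-a) a \<phi>" and "m \<phi> = 0" for \<phi>
  proof -
    have nonneg: "0 \<le> \<delta> \<psi>" if "test_function (-a) a \<psi>" "m \<psi> = 0" for \<psi>
      using first_variation_nonneg[OF assms(1,2,4)] that by (simp add: \<delta>_def m_def)
    \<comment> \<open>this linear combination is \<open>- \<phi>\<close>\<close>
    have "0 \<le> \<delta> (\<lambda>x. - 2 * \<phi> x + \<phi> x)"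
      using combination[OF \<phi> \<phi>, of "- 2"] that by (intro nonneg) simp_all
    then show ?thesis
      using combination(2)[OF \<phi> \<phi>, of "- 2"] nonneg[OF that] by simp
  qed
  have "\<exists>c. \<forall>\<phi>. test_function (-a) a \<phi> \<longrightarrow> \<delta> \<phi> = c * m \<phi>"
  \<comment> \<open>If all means vanished, \<open>\<delta>\<close> would vanish too and any
    \<open>c\<close> would do; the case distinction spares the construction of a test function with
    nonzero mean.\<close>
  proof (cases "\<forall>\<phi>. test_function (-a) a \<phi> \<longrightarrow> m \<phi> = 0")
    case True
    with \<delta>_zero show ?thesis by auto
  next
    case False
    then obtain \<eta> where \<eta>: "test_function (-a) a \<eta>" "m \<eta> \<noteq> 0" by blast
    have "\<delta> \<phi> = \<delta> \<eta> / m \<eta> * m \<phi>" if \<phi>: "test_function (-a) a \<phi>" for \<phi>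
    proof -
      \<comment> \<open>The coefficient of \<open>\<eta>\<close> is the one that makes the mean of
        the combination zero.\<close>
      have "\<delta> (\<lambda>x. (- m \<phi> / m \<eta>) * \<eta> x + \<phi> x) = 0"
        using combination[OF \<eta>(1) \<phi>, of "- m \<phi> / m \<eta>"] \<eta>(2) by (intro \<delta>_zero) simp_all
      then show ?thesis
        using combination(2)[OF \<eta>(1) \<phi>, of "- m \<phi> / m \<eta>"] by (simp add: mult.commute)
    qed
    then show ?thesis by blast
  qed
  then obtain c where c: "\<And>\<phi>. test_function (-a) a \<phi> \<Longrightarrow> \<delta> \<phi> = c * m \<phi>"
    by blast
  show ?thesis
  \<comment> \<open>The left-hand side of the equation unfolds to
    \<open>\<delta> \<phi> + lam * m \<phi>\<close>, so the multiplier is the negative of the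
    proportionality factor.\<close>
  proof (intro exI[of _ "- c"] allI impI)
    fix \<phi> assume \<phi>: "test_function (-a) a \<phi>"
    note \<phi>' = test_function_deriv[OF \<phi>]
    have "(LINT x:{-a..a}|lebesgue. lagrangian_q \<gamma> (?p x) (?q x) * deriv (deriv \<phi>) x)
        + (LINT x:{-a..a}|lebesgue. lagrangian_p \<gamma> (?p x) (?q x) * deriv \<phi> x)
        + (LINT x:{-a..a}|lebesgue. - c * \<phi> x) = 0"
      using c[OF \<phi>] unfolding \<delta>_eq[OF \<phi>] m_def set_integral_mult_right by simp
    then show "dist_deriv (dist_deriv (regular_dist (-a) a
        (\<lambda>x. 2 * \<gamma> * ?q x / (1 + (?p x)\<^sup>2) powr (5/2)))) \<phi>
      - dist_deriv (regular_dist (-a) a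
        (\<lambda>x. ?p x / sqrt (1 + (?p x)\<^sup>2) - 5 * \<gamma> * (?q x)\<^sup>2 * ?p x / (1 + (?p x)\<^sup>2) powr (7/2))) \<phi>
      + regular_dist (-a) a (\<lambda>x. - c) \<phi> = 0"
      unfolding lagrangian_q_def lagrangian_p_def dist_deriv_def regular_dist_def
        test_integral_Icc[OF \<phi>] test_integral_Icc[OF \<phi>'] test_integral_Icc[OF test_function_deriv[OF \<phi>']]
      by simp
  qed
qed

end
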